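(* The set $\mathcal{B}_{1,2,3}$ consisting of the identities (M1) $(xy)(zt)=(xz)(yt)$, (M2) $(xy)(zt)=(ty)(zx)$, (M3) $((xy)z)t=((xt)z)y$, (M4) $(x(yz))t=(x(tz))y$, (M5) $x((yz)t)=z((yx)t)$, (M6) $x(y(zt))=z(y(xt))$, $(x^2z)y^2=(y^2z)x^2$, and $(zx^2)y^2=(zy^2)x^2$ is an independent basis for $\Sigma_{1,2,3}$.
   Context: $x^2$ denotes $xx$. $\Sigma_{1,2,3}$ is the set of groupoid identities satisfied in the integers $\mathbb{Z}$ by each of the binary operations $x+y$, $x-y$ and $-x+y$. A basis is a set of identities whose equational consequences are exactly $\Sigma_{1,2,3}$; it is independent if no member is a consequence of the others. *)

theory Defs
  imports Main
begin

datatype gterm = Var nat | Op gterm gterm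

type_synonym identity = "gterm \<times> gterm"

fun eval :: "(int \<Rightarrow> int \<Rightarrow> int) \<Rightarrow> (nat \<Rightarrow> int) \<Rightarrow> gterm \<Rightarrow> int" where
  "eval f v (Var n) = v n"
| "eval f v (Op s t) = f (eval f v s) (eval f v t)"

definition holds_in :: "(int \<Rightarrow> int \<Rightarrow> int) \<Rightarrow> identity \<Rightarrow> bool" where
  "holds_in f e \<longleftrightarrow> (\<forall>v. eval f v (fst e) = eval f v (snd e))"

definition Sigma123 :: "identity set" where
  "Sigma123 = {e. holds_in (\<lambda>x y. x + y) e \<and> holds_in (\<lambda>x y. x - y) e
                  \<and> holds_in (\<lambda>x y. - x + y) e}"

fun subst :: "(nat \<Rightarrow> gterm) \<Rightarrow> gterm \<Rightarrow> gterm" where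
  "subst \<sigma> (Var n) = \<sigma> n"
| "subst \<sigma> (Op s t) = Op (subst \<sigma> s) (subst \<sigma> t)"

inductive_set consequences :: "identity set \<Rightarrow> identity set" for E where
  ax: "e \<in> E \<Longrightarrow> e \<in> consequences E"
| refl: "(s, s) \<in> consequences E"
| sym: "(s, t) \<in> consequences E \<Longrightarrow> (t, s) \<in> consequences E"
| trans: "(s, t) \<in> consequences E \<Longrightarrow> (t, u) \<in> consequences E \<Longrightarrow> (s, u) \<in> consequences E"
| subst: "(s, t) \<in> consequences E \<Longrightarrow> (subst \<sigma> s, subst \<sigma> t) \<in> consequences E"
| cong: "(s1, t1) \<in> consequences E \<Longrightarrow> (s2, t2) \<in> consequences E
         \<Longrightarrow> (Op s1 s2, Op t1 t2) \<in> consequences E"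

definition is_basis :: "identity set \<Rightarrow> identity set \<Rightarrow> bool" where
  "is_basis B \<Sigma> \<longleftrightarrow> consequences B = \<Sigma>"

definition independent :: "identity set \<Rightarrow> bool" where
  "independent B \<longleftrightarrow> (\<forall>e\<in>B. e \<notin> consequences (B - {e}))"

abbreviation "vx \<equiv> Var 0"
abbreviation "vy \<equiv> Var 1"
abbreviation "vz \<equiv> Var 2"
abbreviation "vt \<equiv> Var 3"

definition B123 :: "identity set" where
  "B123 = {
    (Op (Op vx vy) (Op vz vt), Op (Op vx vz) (Op vy vt)),
    (Op (Op vx vy) (Op vz vt), Op (Op vt vy) (Op vz vx)),
    (Op (Op (Op vx vy) vz) vt, Op (Op (Op vx vt) vz) vy),
    (Op (Op vx (Op vy vz)) vt, Op (Op vx (Op vt vz)) vy),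
    (Op vx (Op (Op vy vz) vt), Op vz (Op (Op vy vx) vt)),
    (Op vx (Op vy (Op vz vt)), Op vz (Op vy (Op vx vt))),
    (Op (Op (Op vx vx) vz) (Op vy vy), Op (Op (Op vy vy) vz) (Op vx vx)),
    (Op (Op vz (Op vx vx)) (Op vy vy), Op (Op vz (Op vy vy)) (Op vx vx))}"

end

theory Submission
  imports Defs "HOL-Library.Multiset" "HOL-Library.Sublist"
begin

text \<open>
Assign to each leaf of a term its class, the parities of the numbers of left and right steps leading
to it. By M1 to M6 any two disjoint subterms of the same class may be exchanged, and such exchanges
connect any two terms in which every variable has the same number of occurrences in each of the
four classes. An identity lies in \<open>Sigma123\<close> iff, for each variable, the occurrence numbers of the
two sides differ by a multiple of \<open>(1, - 1, - 1, 1)\<close> on the classes ordered as 00, 01, 10, 11. If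
two variables have multiples of opposite signs, one step of balancing them is an instance of one of
the last two identities, after moving the term into a suitable shape. If all multiples have the same
sign, their sum is divisible by 3, and three units can be cancelled at once by such an instance in
which a product of two variables is substituted for a variable. For independence, each identity is
refuted in a finite groupoid that satisfies the others.
\<close>

subsection \<open>Evaluation of terms\<close>

text \<open>Polymorphic version of \<open>eval\<close>, needed also over finite tables and over the
  terms modulo \<open>consequences B123\<close>.\<close>

fun evalm :: "('a \<Rightarrow> 'a \<Rightarrow> 'a) \<Rightarrow> (nat \<Rightarrow> 'a) \<Rightarrow> gterm \<Rightarrow> 'a" where
  "evalm f v (Var n) = v n"
| "evalm f v (Op s t) = f (evalm f v s) (evalm f v t)"

lemma evalm_subst: "evalm f v (subst \<sigma> t) = evalm f (\<lambda>n. evalm f v (\<sigma> n)) t"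
  by (induction t) auto

lemma eval_eq_evalm: "eval = evalm"
proof (intro ext)
  show "eval f v t = evalm f v t" for f v t by (induction t) auto
qed

lemma consequences_sound:
  assumes "e \<in> consequences E"
    and "\<forall>e\<in>E. \<forall>v. evalm f v (fst e) = evalm f v (snd e)"
  shows "evalm f v (fst e) = evalm f v (snd e)"
  using assms(1)
proof (induction arbitrary: v)
  case (ax e)
  with assms(2) show ?case by blast
qed (auto simp: evalm_subst)

subsection \<open>Exchanging subterms of the same class\<close>

text \<open>The class of a node records the parities of the numbers of left and right steps on its path
from the root. It determines the sign of a leaf under each of the three operations: always
positive for \<open>x + y\<close>, the parity of right steps for \<open>x - y\<close>, that of left steps for \<open>- x + y\<close>.\<close>

type_synonym cls = "bool \<times> bool"

definition flipL :: "cls \<Rightarrow> cls" where "flipL c = (\<not> fst c, snd c)"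
definition flipR :: "cls \<Rightarrow> cls" where "flipR c = (fst c, \<not> snd c)"
lemmas flip_defs = flipL_def flipR_def

text \<open>The side branches hold groupoid elements rather than terms, since an exchange depends
  only on their values.\<close>

datatype 'a ctx = Hole | CtxL "'a ctx" 'a | CtxR 'a "'a ctx"

fun hole_cls :: "'a ctx \<Rightarrow> cls" where
  "hole_cls Hole = (False, False)"
| "hole_cls (CtxL C t) = flipL (hole_cls C)"
| "hole_cls (CtxR t C) = flipR (hole_cls C)"

fun hole_depth :: "'a ctx \<Rightarrow> nat" where
  "hole_depth Hole = 0"
| "hole_depth (CtxL C t) = Suc (hole_depth C)"
| "hole_depth (CtxR t C) = Suc (hole_depth C)"

locale class_groupoid =
  fixes mul :: "'a \<Rightarrow> 'a \<Rightarrow> 'a" (infixl "\<cdot>" 70)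
  assumes M1: "(x \<cdot> y) \<cdot> (z \<cdot> t) = (x \<cdot> z) \<cdot> (y \<cdot> t)"
    and M2: "(x \<cdot> y) \<cdot> (z \<cdot> t) = (t \<cdot> y) \<cdot> (z \<cdot> x)"
    and M3: "((x \<cdot> y) \<cdot> z) \<cdot> t = ((x \<cdot> t) \<cdot> z) \<cdot> y"
    and M4: "(x \<cdot> (y \<cdot> z)) \<cdot> t = (x \<cdot> (t \<cdot> z)) \<cdot> y"
    and M5: "x \<cdot> ((y \<cdot> z) \<cdot> t) = z \<cdot> ((y \<cdot> x) \<cdot> t)"
    and M6: "x \<cdot> (y \<cdot> (z \<cdot> t)) = z \<cdot> (y \<cdot> (x \<cdot> t))"
begin

fun fill :: "'a ctx \<Rightarrow> 'a \<Rightarrow> 'a" where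
  "fill Hole a = a"
| "fill (CtxL C t) a = fill C a \<cdot> t"
| "fill (CtxR t C) a = t \<cdot> fill C a"

text \<open>The cases of total hole depth 2 are exactly M1 to M6. In all others a few applications of these laws
bring both holes to the same side of the root, so that they branch off at a smaller subterm.\<close>

lemma swap_holes:
  assumes "flipL (hole_cls C) = flipR (hole_cls D)"
  shows "fill C a \<cdot> fill D b = fill C b \<cdot> fill D a"
  using assms
proof (induction "hole_depth C + hole_depth D" arbitrary: C D a b rule: less_induct)
  case (less C D a b)
  show ?case
  proof (cases C)
    case e0: Hole
    show ?thesis
    proof (cases D)
      case e1: Hole
      \<comment> \<open>Two holes at depth one have the classes (True, False) and (False, True),
        against the premise.\<close>
      then show ?thesis using less.prems by (simp add: flipL_def flipR_def e0 e1)
    next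
      case e1: (CtxL B n)
      show ?thesis
      proof (cases B)
        case e2: Hole
        then show ?thesis using less.prems by (simp add: flipL_def flipR_def e0 e1 e2)
      next
        case e2: (CtxL B k)
        \<comment> \<open>In this and the later rearrangements \<open>X\<close> and \<open>Y\<close>
          contain the first and the second hole. On the right both lie in a smaller common subterm,
          here \<open>Y \<cdot> X\<close>, to which the induction hypothesis applies.\<close>
        have eq: "X \<cdot> ((Y \<cdot> k) \<cdot> n) = k \<cdot> ((Y \<cdot> X) \<cdot> n)" for X Y
          by (metis M5)
        show ?thesis
          using less.hyps[of B Hole b a] less.prems
          by (auto simp: flip_defs prod_eq_iff e0 e1 e2 eq)
      next
        case e2: (CtxR k B)
        show ?thesis
        proof (cases B)
          case e3: Hole
          show ?thesis unfolding e0 e1 e2 e3 fill.simps by (rule M5)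
        next
          case e3: (CtxL B p)
          have eq: "X \<cdot> ((k \<cdot> (Y \<cdot> p)) \<cdot> n) = (Y \<cdot> (k \<cdot> X)) \<cdot> (p \<cdot> n)" for X Y
            by (metis M1 M5)
          show ?thesis
            using less.hyps[of B "CtxR k Hole" b a] less.prems
            by (auto simp: flip_defs prod_eq_iff e0 e1 e2 e3 eq)
        next
          case e3: (CtxR p B)
          have eq: "X \<cdot> ((k \<cdot> (p \<cdot> Y)) \<cdot> n) = (p \<cdot> ((Y \<cdot> n) \<cdot> X)) \<cdot> k" for X Y
            by (metis M1 M4 M5)
          show ?thesis
            using less.hyps[of "CtxL B n" Hole b a] less.prems
            by (auto simp: flip_defs prod_eq_iff e0 e1 e2 e3 eq)
        qed
      qed
    next
      case e1: (CtxR n B)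
      show ?thesis
      proof (cases B)
        case e2: Hole
        then show ?thesis using less.prems by (simp add: flipL_def flipR_def e0 e1 e2)
      next
        case e2: (CtxL B k)
        show ?thesis
        proof (cases B)
          case e3: Hole
          show ?thesis unfolding e0 e1 e2 e3 fill.simps by (rule M6)
        next
          case e3: (CtxL B p)
          have eq: "X \<cdot> (n \<cdot> ((Y \<cdot> p) \<cdot> k)) = ((X \<cdot> (n \<cdot> Y)) \<cdot> p) \<cdot> k" for X Y
            by (metis M2 M3 M6)
          show ?thesis
            using less.hyps[of Hole "CtxR n B" a b] less.prems
            by (auto simp: flip_defs prod_eq_iff e0 e1 e2 e3 eq)
        next
          case e3: (CtxR p B)
          have eq: "X \<cdot> (n \<cdot> ((p \<cdot> Y) \<cdot> k)) = (p \<cdot> n) \<cdot> (Y \<cdot> (X \<cdot> k))" for X Y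
            by (metis M1 M6)
          show ?thesis
            using less.hyps[of B "CtxL Hole k" b a] less.prems
            by (auto simp: flip_defs prod_eq_iff e0 e1 e2 e3 eq)
        qed
      next
        case e2: (CtxR k B)
        have eq: "X \<cdot> (n \<cdot> (k \<cdot> Y)) = k \<cdot> (n \<cdot> (X \<cdot> Y))" for X Y
          by (metis M6)
        show ?thesis
          using less.hyps[of Hole B a b] less.prems
          by (auto simp: flip_defs prod_eq_iff e0 e1 e2 eq)
      qed
    qed
  next
    case e0: (CtxL A m)
    show ?thesis
    proof (cases D)
      case e1: Hole
      show ?thesis
      proof (cases A)
        case e2: Hole
        then show ?thesis using less.prems by (simp add: flipL_def flipR_def e0 e1 e2)
      next
        case e2: (CtxL A k)
        have eq: "((X \<cdot> k) \<cdot> m) \<cdot> Y = ((X \<cdot> Y) \<cdot> m) \<cdot> k" for X Y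
          by (metis M3)
        show ?thesis
          using less.hyps[of A Hole a b] less.prems
          by (auto simp: flip_defs prod_eq_iff e0 e1 e2 eq)
      next
        case e2: (CtxR k A)
        show ?thesis
        proof (cases A)
          case e3: Hole
          show ?thesis unfolding e0 e1 e2 e3 fill.simps by (rule M3)
        next
          case e3: (CtxL A p)
          have eq: "((k \<cdot> (X \<cdot> p)) \<cdot> m) \<cdot> Y = ((k \<cdot> Y) \<cdot> X) \<cdot> (m \<cdot> p)" for X Y
            by (metis M1 M3)
          show ?thesis
            using less.hyps[of "CtxR k Hole" A b a] less.prems
            by (auto simp: flip_defs prod_eq_iff e0 e1 e2 e3 eq)
        next
          case e3: (CtxR p A)
          have eq: "((k \<cdot> (p \<cdot> X)) \<cdot> m) \<cdot> Y = k \<cdot> (p \<cdot> ((X \<cdot> m) \<cdot> Y))" for X Y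
            by (metis M2 M3 M6)
          show ?thesis
            using less.hyps[of "CtxL A m" Hole a b] less.prems
            by (auto simp: flip_defs prod_eq_iff e0 e1 e2 e3 eq)
        qed
      qed
    next
      case e1: (CtxL B n)
      have eq: "(X \<cdot> m) \<cdot> (Y \<cdot> n) = (X \<cdot> Y) \<cdot> (m \<cdot> n)" for X Y
        by (metis M1)
      show ?thesis
        using less.hyps[of A B a b] less.prems
        by (auto simp: flip_defs prod_eq_iff e0 e1 eq)
    next
      case e1: (CtxR n B)
      show ?thesis
      proof (cases A)
        case e2: Hole
        show ?thesis
        proof (cases B)
          case e3: Hole
          show ?thesis unfolding e0 e1 e2 e3 fill.simps by (rule M2)
        next
          case e3: (CtxL B p)
          have eq: "(X \<cdot> m) \<cdot> (n \<cdot> (Y \<cdot> p)) = ((Y \<cdot> (n \<cdot> X)) \<cdot> m) \<cdot> p" for X Y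
            by (metis M2 M3)
          show ?thesis
            using less.hyps[of B "CtxR n Hole" b a] less.prems
            by (auto simp: flip_defs prod_eq_iff e0 e1 e2 e3 eq)
        next
          case e3: (CtxR p B)
          have eq: "(X \<cdot> m) \<cdot> (n \<cdot> (p \<cdot> Y)) = p \<cdot> (n \<cdot> ((X \<cdot> m) \<cdot> Y))" for X Y
            by (metis M6)
          show ?thesis
            using less.hyps[of "CtxL Hole m" B a b] less.prems
            by (auto simp: flip_defs prod_eq_iff e0 e1 e2 e3 eq)
        qed
      next
        case e2: (CtxL A k)
        have eq: "((X \<cdot> k) \<cdot> m) \<cdot> (n \<cdot> Y) = ((X \<cdot> (n \<cdot> Y)) \<cdot> m) \<cdot> k" for X Y
          by (metis M3)
        show ?thesis
          using less.hyps[of A "CtxR n B" a b] less.prems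
          by (auto simp: flip_defs prod_eq_iff e0 e1 e2 eq)
      next
        case e2: (CtxR k A)
        have eq: "((k \<cdot> X) \<cdot> m) \<cdot> (n \<cdot> Y) = k \<cdot> (n \<cdot> ((Y \<cdot> m) \<cdot> X))" for X Y
          by (metis M2 M6)
        show ?thesis
          using less.hyps[of "CtxL B m" A b a] less.prems
          by (auto simp: flip_defs prod_eq_iff e0 e1 e2 eq)
      qed
    qed
  next
    case e0: (CtxR m A)
    show ?thesis
    proof (cases D)
      case e1: Hole
      show ?thesis
      proof (cases A)
        case e2: Hole
        then show ?thesis using less.prems by (simp add: flipL_def flipR_def e0 e1 e2)
      next
        case e2: (CtxL A k)
        show ?thesis
        proof (cases A)
          case e3: Hole
          show ?thesis unfolding e0 e1 e2 e3 fill.simps by (rule M4)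
        next
          case e3: (CtxL A p)
          have eq: "(m \<cdot> ((X \<cdot> p) \<cdot> k)) \<cdot> Y = k \<cdot> ((Y \<cdot> (m \<cdot> X)) \<cdot> p)" for X Y
            by (metis M1 M4 M5)
          show ?thesis
            using less.hyps[of Hole "CtxR m A" b a] less.prems
            by (auto simp: flip_defs prod_eq_iff e0 e1 e2 e3 eq)
        next
          case e3: (CtxR p A)
          have eq: "(m \<cdot> ((p \<cdot> X) \<cdot> k)) \<cdot> Y = (m \<cdot> p) \<cdot> ((Y \<cdot> k) \<cdot> X)" for X Y
            by (metis M1 M4)
          show ?thesis
            using less.hyps[of "CtxL Hole k" A b a] less.prems
            by (auto simp: flip_defs prod_eq_iff e0 e1 e2 e3 eq)
        qed
      next
        case e2: (CtxR k A)
        have eq: "(m \<cdot> (k \<cdot> X)) \<cdot> Y = (m \<cdot> (Y \<cdot> X)) \<cdot> k" for X Y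
          by (metis M4)
        show ?thesis
          using less.hyps[of Hole A b a] less.prems
          by (auto simp: flip_defs prod_eq_iff e0 e1 e2 eq)
      qed
    next
      case e1: (CtxL B n)
      show ?thesis
      proof (cases A)
        case e2: Hole
        show ?thesis
        proof (cases B)
          case e3: Hole
          show ?thesis unfolding e0 e1 e2 e3 fill.simps by (rule M1)
        next
          case e3: (CtxL B p)
          have eq: "(m \<cdot> X) \<cdot> ((Y \<cdot> p) \<cdot> n) = p \<cdot> ((Y \<cdot> (m \<cdot> X)) \<cdot> n)" for X Y
            by (metis M5)
          show ?thesis
            using less.hyps[of B "CtxR m Hole" b a] less.prems
            by (auto simp: flip_defs prod_eq_iff e0 e1 e2 e3 eq)
        next
          case e3: (CtxR p B)
          have eq: "(m \<cdot> X) \<cdot> ((p \<cdot> Y) \<cdot> n) = (m \<cdot> ((X \<cdot> n) \<cdot> Y)) \<cdot> p" for X Y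
            by (metis M1 M4)
          show ?thesis
            using less.hyps[of "CtxL Hole n" B a b] less.prems
            by (auto simp: flip_defs prod_eq_iff e0 e1 e2 e3 eq)
        qed
      next
        case e2: (CtxL A k)
        have eq: "(m \<cdot> (X \<cdot> k)) \<cdot> (Y \<cdot> n) = k \<cdot> ((X \<cdot> (m \<cdot> Y)) \<cdot> n)" for X Y
          by (metis M1 M5)
        show ?thesis
          using less.hyps[of A "CtxR m B" a b] less.prems
          by (auto simp: flip_defs prod_eq_iff e0 e1 e2 eq)
      next
        case e2: (CtxR k A)
        have eq: "(m \<cdot> (k \<cdot> X)) \<cdot> (Y \<cdot> n) = (m \<cdot> ((Y \<cdot> n) \<cdot> X)) \<cdot> k" for X Y
          by (metis M4)
        show ?thesis
          using less.hyps[of "CtxL B n" A b a] less.prems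
          by (auto simp: flip_defs prod_eq_iff e0 e1 e2 eq)
      qed
    next
      case e1: (CtxR n B)
      have eq: "(m \<cdot> X) \<cdot> (n \<cdot> Y) = (m \<cdot> n) \<cdot> (X \<cdot> Y)" for X Y
        by (metis M1)
      show ?thesis
        using less.hyps[of A B a b] less.prems
        by (auto simp: flip_defs prod_eq_iff e0 e1 eq)
    qed
  qed
qed

end

subsection \<open>Leaf profiles\<close>

lemma flip_simps [simp]:
  "flipL (flipL c) = c" "flipR (flipR c) = c" "flipR (flipL c) = flipL (flipR c)"
  by (simp_all add: flip_defs)

text \<open>Addition in Z/2 x Z/2. Every class is its own negative, so
  \<open>c \<oplus> pos_cls p\<close> is the class, relative to the node at \<open>p\<close>, of a
  node below it that has class \<open>c\<close>.\<close>

definition cls_add :: "cls \<Rightarrow> cls \<Rightarrow> cls" (infixl "\<oplus>" 65) where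
  "c \<oplus> d = (fst c \<noteq> fst d, snd c \<noteq> snd d)"

lemma flip_add [simp]:
  "flipL c \<oplus> d = flipL (c \<oplus> d)" "c \<oplus> flipL d = flipL (c \<oplus> d)"
  "flipR c \<oplus> d = flipR (c \<oplus> d)" "c \<oplus> flipR d = flipR (c \<oplus> d)"
  by (auto simp: flip_defs cls_add_def)

lemma cls_add_zero [simp]: "c \<oplus> (False, False) = c"
  by (simp add: cls_add_def)

fun prof :: "gterm \<Rightarrow> cls \<Rightarrow> nat multiset" where
  "prof (Var i) c = (if c = (False, False) then {#i#} else {#})"
| "prof (Op s t) c = prof s (flipL c) + prof t (flipR c)"

fun inn :: "gterm \<Rightarrow> cls \<Rightarrow> nat" where
  "inn (Var i) c = 0"
| "inn (Op s t) c = of_bool (c = (False, False)) + inn s (flipL c) + inn t (flipR c)"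

lemma flip_eq_iff: "flipL c = d \<longleftrightarrow> c = flipL d" "flipR c = d \<longleftrightarrow> c = flipR d"
  by (auto simp: flip_defs)

text \<open>Both sides count the nodes of class \<open>c\<close>: as leaves or inner nodes, and as
  the root or a left or right child of an inner node.\<close>

lemma inn_balance:
  "size (prof t c) + inn t c = of_bool (c = (False, False)) + inn t (flipL c) + inn t (flipR c)"
proof (induction t arbitrary: c)
  case (Op s t)
  from Op.IH(1)[of "flipL c"] Op.IH(2)[of "flipR c"] show ?case by simp
qed simp

lemma flip_pair [simp]: "flipL (a, b) = (\<not> a, b)" "flipR (a, b) = (a, \<not> b)"
  by (simp_all add: flip_defs)

text \<open>The balance equations determine the numbers of inner nodes from those of leaves, because the
element \<open>l + r - 1\<close> of the group ring of \<open>Z/2 x Z/2\<close> is not a zero divisor.\<close>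

lemma inn_cong:
  assumes "prof S = prof T"
  shows "inn S = inn T"
proof
  fix c :: cls
  \<comment> \<open>The difference of the inner node counts satisfies
    \<open>x c = x (flipL c) + x (flipR c)\<close>. So it has one value a on 00 and 11 and one value
    b on 01 and 10, and a = 2b, b = 2a force zero.\<close>
  have *: "inn S d + inn T (flipL d) + inn T (flipR d) = inn T d + inn S (flipL d) + inn S (flipR d)" for d
    using inn_balance[of S d] inn_balance[of T d] assms by simp
  show "inn S c = inn T c"
    using *[of "(False, False)"] *[of "(False, True)"] *[of "(True, False)"] *[of "(True, True)"]
    by (cases c rule: prod.exhaust; cases "fst c"; cases "snd c"; simp; linarith)
qed

text \<open>The generated \<open>size\<close> gives leaves size 0.\<close>

lemma size_eq_inn:
  "size t = inn t (False, False) + inn t (False, True) + inn t (True, False) + inn t (True, True)"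
  by (induction t) auto

text \<open>Positions are lists of steps, with \<open>True\<close> for a step to the right.\<close>

fun subt :: "gterm \<Rightarrow> bool list \<Rightarrow> gterm option" where
  "subt t [] = Some t"
| "subt (Op s t) (d # p) = subt (if d then t else s) p"
| "subt (Var i) (d # p) = None"

fun repl :: "gterm \<Rightarrow> bool list \<Rightarrow> gterm \<Rightarrow> gterm" where
  "repl t [] u = u"
| "repl (Op s t) (d # p) u = (if d then Op s (repl t p u) else Op (repl s p u) t)"
| "repl (Var i) (d # p) u = Var i"

fun pos_cls :: "bool list \<Rightarrow> cls" where
  "pos_cls [] = (False, False)"
| "pos_cls (d # p) = (if d then flipR else flipL) (pos_cls p)"

fun lab :: "gterm \<Rightarrow> nat option" where
  "lab (Var i) = Some i"
| "lab (Op s t) = None"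

text \<open>The profile of a subterm enters shifted by the class of its position. Adding the removed
  part on the left avoids multiset subtraction.\<close>

lemma prof_repl:
  "subt S p = Some a \<Longrightarrow>
     prof (repl S p u) c + prof a (c \<oplus> pos_cls p) = prof S c + prof u (c \<oplus> pos_cls p)"
proof (induction S p arbitrary: c rule: subt.induct)
  case (2 s t d p)
  show ?case
  proof (rule multiset_eqI)
    show "count (prof (repl (Op s t) (d # p) u) c + prof a (c \<oplus> pos_cls (d # p))) x
        = count (prof (Op s t) c + prof u (c \<oplus> pos_cls (d # p))) x" for x
      using arg_cong[OF "2.IH"[of "if d then flipR c else flipL c"], of "\<lambda>M. count M x"] "2.prems"
      by (cases d) simp_all
  qed
qed auto

lemma inn_repl:
  "subt S p = Some a \<Longrightarrow>
     inn (repl S p u) c + inn a (c \<oplus> pos_cls p) = inn S c + inn u (c \<oplus> pos_cls p)"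
proof (induction S p arbitrary: c rule: subt.induct)
  case (2 s t d p)
  show ?case
    using "2.IH"[of "if d then flipR c else flipL c"] "2.prems"
    by (cases d) simp_all
qed auto

context class_groupoid
begin

abbreviation ev where "ev \<equiv> evalm (\<cdot>)"

lemma repl_ctx:
  assumes "subt S p = Some a"
  shows "\<exists>C. hole_cls C = pos_cls p \<and> (\<forall>u. ev v (repl S p u) = fill C (ev v u))"
  using assms
proof (induction S p rule: subt.induct)
  case (1 t)
  have "hole_cls Hole = pos_cls [] \<and> (\<forall>u. ev v (repl t [] u) = fill Hole (ev v u))"
    by simp
  then show ?case by blast
next
  case (2 s t d p)
  then obtain C where "hole_cls C = pos_cls p"
      "\<And>u. ev v (repl (if d then t else s) p u) = fill C (ev v u)"
    by auto
  then have "hole_cls (if d then CtxR (ev v s) C else CtxL C (ev v t)) = pos_cls (d # p) \<and>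
     (\<forall>u. ev v (repl (Op s t) (d # p) u) = fill (if d then CtxR (ev v s) C else CtxL C (ev v t)) (ev v u))"
    by (cases d) simp_all
  then show ?case by blast
qed auto

lemma repl_self: "subt S p = Some a \<Longrightarrow> repl S p a = S"
  by (induction S p rule: subt.induct) (auto split: if_splits)

text \<open>Descending along the common prefix \<open>r\<close> reduces the claim to
  \<open>swap_holes\<close> at the node where the two paths part.\<close>

lemma ev_swap:
  assumes "subt S (r @ False # p) = Some a" "subt S (r @ True # q) = Some b"
    "pos_cls (r @ False # p) = pos_cls (r @ True # q)"
  shows "ev v (repl (repl S (r @ False # p) b) (r @ True # q) a) = ev v S"
  using assms
proof (induction r arbitrary: S)
  case Nil
  then obtain s t where S: "S = Op s t" by (cases S) auto
  with Nil have st: "subt s p = Some a" "subt t q = Some b" by auto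
  obtain C where C: "hole_cls C = pos_cls p" "\<And>u. ev v (repl s p u) = fill C (ev v u)"
    using repl_ctx[OF st(1)] by blast
  obtain D where D: "hole_cls D = pos_cls q" "\<And>u. ev v (repl t q u) = fill D (ev v u)"
    using repl_ctx[OF st(2)] by blast
  have "fill C (ev v b) \<cdot> fill D (ev v a) = fill C (ev v a) \<cdot> fill D (ev v b)"
    using Nil.prems(3) C(1) D(1) by (intro swap_holes) simp
  then have "ev v (repl s p b) \<cdot> ev v (repl t q a) = ev v (repl s p a) \<cdot> ev v (repl t q b)"
    by (simp add: C D)
  then show ?case by (simp add: S repl_self st)
next
  case (Cons d r)
  then obtain s t where S: "S = Op s t" by (cases S) auto
  show ?case
    using Cons.IH[of "if d then t else s"] Cons.prems
    by (cases d) (simp_all add: S flip_eq_iff)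
qed

end

subsection \<open>The leaf profile determines the value\<close>

definition nodes :: "nat option \<Rightarrow> gterm \<Rightarrow> cls \<Rightarrow> bool list set" where
  "nodes l t c = {p. pos_cls p = c \<and> (\<exists>u. subt t p = Some u \<and> lab u = l)}"

lemma nodes_Var: "nodes l (Var i) c = (if c = (False, False) \<and> l = Some i then {[]} else {})"
proof -
  have "p \<in> nodes l (Var i) c \<longleftrightarrow> p \<in> (if c = (False, False) \<and> l = Some i then {[]} else {})" for p
    by (cases p) (auto simp: nodes_def)
  then show ?thesis by blast
qed

lemma nodes_Op:
  "nodes l (Op s t) c = (if c = (False, False) \<and> l = None then {[]} else {})
     \<union> (#) False ` nodes l s (flipL c) \<union> (#) True ` nodes l t (flipR c)"
proof -
  have "p \<in> nodes l (Op s t) c \<longleftrightarrow> p \<in> (if c = (False, False) \<and> l = None then {[]} else {})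
     \<union> (#) False ` nodes l s (flipL c) \<union> (#) True ` nodes l t (flipR c)" for p
  proof (cases p)
    case (Cons d q)
    then show ?thesis by (cases d) (auto simp: nodes_def flip_eq_iff)
  qed (auto simp: nodes_def)
  then show ?thesis by blast
qed

lemma finite_nodes: "finite (nodes l t c)"
  by (induction t arbitrary: c) (auto simp: nodes_Var nodes_Op)

lemma card_nodes:
  "card (nodes l t c) = (case l of None \<Rightarrow> inn t c | Some i \<Rightarrow> count (prof t c) i)"
proof (induction t arbitrary: c)
  case (Op s t)
  let ?A = "if c = (False, False) \<and> l = None then {[]} else {} :: bool list set"
  have "card (nodes l (Op s t) c)
      = card (?A \<union> (#) False ` nodes l s (flipL c)) + card ((#) True ` nodes l t (flipR c))"
    unfolding nodes_Op by (intro card_Un_disjoint) (auto simp: finite_nodes)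
  also have "card (?A \<union> (#) False ` nodes l s (flipL c)) = card ?A + card ((#) False ` nodes l s (flipL c))"
    by (intro card_Un_disjoint) (auto simp: finite_nodes)
  also have "card ((#) False ` nodes l s (flipL c)) = card (nodes l s (flipL c))"
    by (simp add: card_image)
  also have "card ((#) True ` nodes l t (flipR c)) = card (nodes l t (flipR c))"
    by (simp add: card_image)
  finally show ?case by (auto simp: Op.IH split: option.splits)
qed (auto simp: nodes_Var split: option.splits)

text \<open>As \<open>size\<close> counts inner nodes, \<open>S\<close> cannot have a product at
  every place where it departs from \<open>T\<close>. In the induction some unequal pair of factors
  again satisfies the size bound.\<close>

lemma differing_leaf:
  "S \<noteq> T \<Longrightarrow> size S \<le> size T \<Longrightarrow> \<exists>p x U. subt S p = Some (Var x) \<and> subt T p = Some U \<and> U \<noteq> Var x"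
proof (induction S arbitrary: T)
  case (Var x)
  then have "subt (Var x) [] = Some (Var x) \<and> subt T [] = Some T \<and> T \<noteq> Var x" by auto
  then show ?case by blast
next
  case (Op a b)
  then obtain a' b' where T: "T = Op a' b'" by (cases T) auto
  consider "a \<noteq> a'" "size a \<le> size a'" | "b \<noteq> b'" "size b \<le> size b'"
    using Op.prems unfolding T by (cases "size a \<le> size a'"; cases "a = a'"; fastforce)
  then show ?case
  proof cases
    case 1
    then obtain p x U where "subt a p = Some (Var x)" "subt a' p = Some U" "U \<noteq> Var x"
      using Op.IH(1) by blast
    then have "subt (Op a b) (False # p) = Some (Var x) \<and> subt T (False # p) = Some U \<and> U \<noteq> Var x"
      by (simp add: T)
    then show ?thesis by blast
  next
    case 2
    then obtain p x U where "subt b p = Some (Var x)" "subt b' p = Some U" "U \<noteq> Var x"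
      using Op.IH(2) by blast
    then have "subt (Op a b) (True # p) = Some (Var x) \<and> subt T (True # p) = Some U \<and> U \<noteq> Var x"
      by (simp add: T)
    then show ?thesis by blast
  qed
qed

lemma subt_append: "subt S (p @ q) = (case subt S p of None \<Rightarrow> None | Some u \<Rightarrow> subt u q)"
  by (induction S p rule: subt.induct) auto

lemma subt_repl_same: "subt S p \<noteq> None \<Longrightarrow> subt (repl S p u) p = Some u"
  by (induction S p rule: subt.induct) auto

text \<open>Besides positions disjoint from \<open>p\<close> this covers those above it, where an
  inner node stays an inner node.\<close>

lemma lab_repl:
  "\<not> prefix p r \<Longrightarrow> map_option lab (subt (repl S p u) r) = map_option lab (subt S r)"
proof (induction S p u arbitrary: r rule: repl.induct)
  case (2 s t d p u)
  then show ?case by (cases r) auto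
qed auto

lemma subt_repl_parallel: "p \<parallel> q \<Longrightarrow> subt (repl S p u) q = subt S q"
proof (induction S p u arbitrary: q rule: repl.induct)
  case (2 s t d p u)
  show ?case
  proof (cases q)
    case (Cons e q')
    with 2 show ?thesis by (cases "e = d") (auto simp: parallel_def)
  qed (use 2 in auto)
qed auto

lemma repl_repl_parallel: "p \<parallel> q \<Longrightarrow> repl (repl S p u) q w = repl (repl S q w) p u"
proof (induction S p u arbitrary: q rule: repl.induct)
  case (2 s t d p u)
  show ?case
  proof (cases q)
    case (Cons e q')
    with 2 show ?thesis by (cases "e = d") (auto simp: parallel_def)
  qed (use 2 in auto)
next
  case (3 i d p u)
  then show ?case by (cases q) auto
qed auto

definition matched :: "gterm \<Rightarrow> gterm \<Rightarrow> bool list set" where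
  "matched S T = {p. \<exists>U V. subt S p = Some U \<and> subt T p = Some V \<and> lab U = lab V}"

lemma finite_positions: "finite {p. subt T p \<noteq> None}"
proof -
  have "{p. subt T p \<noteq> None} \<subseteq> {p. set p \<subseteq> UNIV \<and> length p \<le> size T}"
  proof (intro subsetI CollectI conjI)
    fix p assume "p \<in> {p. subt T p \<noteq> None}"
    then show "length p \<le> size T"
      by simp (induction T p rule: subt.induct; fastforce split: if_splits)
  qed simp
  then show ?thesis using finite_lists_length_le[of "UNIV :: bool set"] finite_subset by fastforce
qed

context class_groupoid
begin

lemma swap_parallel:
  assumes "p \<parallel> q" "subt S p = Some a" "subt S q = Some b" "pos_cls p = pos_cls q"
  shows "ev v (repl (repl S p b) q a) = ev v S"
proof -
  obtain r d p' e q' where r: "d \<noteq> e" "p = r @ d # p'" "q = r @ e # q'"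
    using parallel_decomp[OF assms(1)] by blast
  show ?thesis
  proof (cases d)
    case False
    with r assms show ?thesis by (auto intro!: ev_swap)
  next
    case True
    have "ev v (repl (repl S q a) p b) = ev v S"
      using r True assms by (auto intro!: ev_swap)
    then show ?thesis using repl_repl_parallel[OF assms(1)] by simp
  qed
qed

text \<open>Where \<open>S\<close> has a leaf and \<open>T\<close> a different node, equality of the profiles yields a node of
\<open>S\<close> with the same label and class as that node of \<open>T\<close> which is not matched by \<open>T\<close>. It lies
disjoint from the leaf, and exchanging the two enlarges the common top part of \<open>S\<close> and \<open>T\<close>.\<close>

theorem ev_cong_prof:
  assumes "prof S = prof T"
  shows "ev v S = ev v T"
  using assms
proof (induction "card ({p. subt T p \<noteq> None} - matched S T)" arbitrary: S rule: less_induct)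
  case (less S)
  show ?case
  proof (cases "S = T")
    case False
    have inn_eq: "inn S = inn T" by (rule inn_cong[OF less.prems])
    have card_eq: "card (nodes l S c) = card (nodes l T c)" for l c
      by (cases l) (simp_all add: card_nodes inn_eq less.prems)
    have "size S \<le> size T" by (simp add: size_eq_inn inn_eq)
    then obtain p x U where p: "subt S p = Some (Var x)" "subt T p = Some U" "U \<noteq> Var x"
      using differing_leaf False by blast
    define l where "l = lab U"
    have l: "l \<noteq> Some x" using p(3) by (cases U) (auto simp: l_def)
    have pT: "p \<in> nodes l T (pos_cls p)" and pS: "p \<notin> nodes l S (pos_cls p)"
      using p l by (auto simp: nodes_def l_def)
    \<comment> \<open>Both sets are finite of equal cardinality, so inclusion would make them equal,
      but \<open>p\<close> lies only in the second.\<close>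
    have "\<not> nodes l S (pos_cls p) \<subseteq> nodes l T (pos_cls p)"
      using card_subset_eq[OF finite_nodes _ card_eq] pT pS by blast
    then obtain q where q: "q \<in> nodes l S (pos_cls p)" "q \<notin> nodes l T (pos_cls p)"
      by blast
    then obtain Y where Y: "subt S q = Some Y" "lab Y = l" "pos_cls q = pos_cls p"
      by (auto simp: nodes_def)
    have no_below_p: "r = p" if r: "prefix p r" "subt S r \<noteq> None" for r
    proof -
      obtain zs where "r = p @ zs" using r(1) by (auto simp: prefix_def)
      with r(2) p(1) show ?thesis by (cases zs) (auto simp: subt_append)
    qed
    \<comment> \<open>If both terms had a node properly below \<open>q\<close>, both would have an
      inner node at \<open>q\<close>, against the choice of \<open>q\<close>.\<close>
    have below_q: "r = q" if r: "prefix q r" "subt S r \<noteq> None" "subt T r \<noteq> None" for r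
    proof (rule ccontr)
      assume "r \<noteq> q"
      then obtain d r' where r': "r = q @ d # r'"
        using r(1) by (metis append_Nil2 neq_Nil_conv prefix_def)
      obtain V where V: "subt T q = Some V" "subt V (d # r') \<noteq> None"
        using r(3) by (auto simp: r' subt_append split: option.splits)
      have "lab V = None" using V(2) by (cases V) auto
      moreover have "lab Y = None"
        using r(2) Y(1) by (cases Y) (auto simp: r' subt_append)
      ultimately show False using q(2) Y V(1) by (auto simp: nodes_def)
    qed
    have par: "p \<parallel> q"
    proof (rule parallelI)
      show "\<not> prefix p q" using no_below_p[of q] Y q pS by auto
      show "\<not> prefix q p" using below_q[of p] p q pS by auto
    qed
    define S' where "S' = repl (repl S p Y) q (Var x)"
    have S': "subt S' p = Some Y"
      unfolding S'_def repl_repl_parallel[OF par]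
      by (rule subt_repl_same) (use subt_repl_parallel[of q p] par p(1) in \<open>simp add: parallel_commute\<close>)
    have subq: "subt (repl S p Y) q = Some Y"
      using subt_repl_parallel[OF par] Y(1) by simp
    have "prof S' = prof S"
    proof
      fix c
      have "prof (repl S p Y) c + prof (Var x) (c \<oplus> pos_cls p) = prof S c + prof Y (c \<oplus> pos_cls p)"
        using prof_repl[OF p(1)] .
      moreover have "prof S' c + prof Y (c \<oplus> pos_cls p) = prof (repl S p Y) c + prof (Var x) (c \<oplus> pos_cls p)"
        using prof_repl[OF subq] Y(3) by (simp add: S'_def)
      ultimately show "prof S' c = prof S c" by (metis add_right_cancel)
    qed
    \<comment> \<open>The exchange alters labels only at or below \<open>p\<close> and
      \<open>q\<close>, where no position was matched.\<close>
    have sub: "matched S T \<subseteq> matched S' T"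
    proof
      fix r assume r: "r \<in> matched S T"
      then have ex: "subt S r \<noteq> None" "subt T r \<noteq> None" by (auto simp: matched_def)
      have "\<not> prefix p r" using no_below_p[of r] ex(1) r p l by (auto simp: matched_def l_def)
      moreover have "\<not> prefix q r"
        using below_q[of r] ex r Y q by (auto simp: matched_def nodes_def)
      ultimately have "map_option lab (subt S' r) = map_option lab (subt S r)"
        unfolding S'_def by (simp add: lab_repl)
      then show "r \<in> matched S' T" using r by (auto simp: matched_def)
    qed
    have "p \<in> matched S' T" "p \<notin> matched S T"
      using S' p Y(2) l by (auto simp: matched_def l_def)
    with sub p(2) have "{p. subt T p \<noteq> None} - matched S' T \<subset> {p. subt T p \<noteq> None} - matched S T"
      by blast
    then have "card ({p. subt T p \<noteq> None} - matched S' T) < card ({p. subt T p \<noteq> None} - matched S T)"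
      using finite_positions[of T] by (intro psubset_card_mono) auto
    then have "ev v S' = ev v T"
      by (rule less.hyps) (simp add: \<open>prof S' = prof S\<close> less.prems)
    moreover have "ev v S' = ev v S"
      unfolding S'_def by (rule swap_parallel[OF par p(1) Y(1)]) (simp add: Y(3))
    ultimately show ?thesis by simp
  qed simp
qed

end

subsection \<open>Realizable profiles\<close>

lemma leaf_at_cls:
  "i \<in># prof X c \<Longrightarrow> \<exists>p. subt X p = Some (Var i) \<and> pos_cls p = c"
proof -
  assume "i \<in># prof X c"
  then have "card (nodes (Some i) X c) \<noteq> 0" by (simp add: card_nodes)
  then obtain p u where "subt X p = Some u" "lab u = Some i" "pos_cls p = c"
    by (auto simp: nodes_def card_eq_0_iff)
  then show ?thesis by (cases u) auto
qed

text \<open>A lowest inner node has two leaves as children, and siblings differ in both parities.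
  Either opposite pair is allowed, so the claim survives the flips in the induction.\<close>

lemma cherry:
  "inn X (False, False) > 0 \<Longrightarrow>
     prof X (False, False) \<noteq> {#} \<and> prof X (True, True) \<noteq> {#} \<or>
     prof X (False, True) \<noteq> {#} \<and> prof X (True, False) \<noteq> {#}"
proof (induction X)
  case (Op s t)
  show ?case
  proof (cases s)
    case s: (Var i)
    show ?thesis
    proof (cases t)
      case (Var j)
      with s show ?thesis by simp
    next
      case (Op t1 t2)
      with Op.IH(2) show ?thesis by auto
    qed
  next
    case (Op s1 s2)
    with Op.IH(1) show ?thesis by auto
  qed
qed simp

lemma inn_root: "inn X c > 0 \<Longrightarrow> inn X (False, False) > 0"
  by (cases X) auto

lemma split_multiset:
  fixes M :: "'a multiset"
  shows "size M = a + b \<Longrightarrow> \<exists>M1 M2. M = M1 + M2 \<and> size M1 = a \<and> size M2 = b"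
proof (induction a arbitrary: M)
  case (Suc a)
  then obtain x N where "M = add_mset x N" by (metis size_eq_Suc_imp_eq_union add_Suc)
  with Suc obtain N1 N2 where "N = N1 + N2" "size N1 = a" "size N2 = b" by force
  then have "M = add_mset x N1 + N2 \<and> size (add_mset x N1) = Suc a \<and> size N2 = b"
    using \<open>M = add_mset x N\<close> by simp
  then show ?case by blast
qed auto

lemma relabel:
  "(\<And>c. size (M c) = size (prof X c)) \<Longrightarrow> \<exists>Y. prof Y = M"
proof (induction X arbitrary: M)
  case (Var i)
  then have "size (M (False, False)) = 1" by simp
  have *: "M c = {#}" if "c \<noteq> (False, False)" for c
    using Var[of c] that by simp
  with \<open>size (M (False, False)) = 1\<close> obtain j where "M (False, False) = {#j#}"
    by (metis size_1_singleton_mset)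
  then have "prof (Var j) = M" using * by (intro ext) auto
  then show ?case by blast
next
  case (Op s t)
  have "\<exists>M1 M2. M c = M1 + M2 \<and> size M1 = size (prof s (flipL c)) \<and> size M2 = size (prof t (flipR c))" for c
    using Op.prems[of c] by (intro split_multiset) simp
  then obtain M1 M2 where M12: "\<And>c. M c = M1 c + M2 c"
      "\<And>c. size (M1 c) = size (prof s (flipL c))" "\<And>c. size (M2 c) = size (prof t (flipR c))"
    by metis
  obtain s' where s': "prof s' = (\<lambda>c. M1 (flipL c))"
    using Op.IH(1)[of "\<lambda>c. M1 (flipL c)"] M12(2) by auto
  obtain t' where t': "prof t' = (\<lambda>c. M2 (flipR c))"
    using Op.IH(2)[of "\<lambda>c. M2 (flipR c)"] M12(3) by auto
  have "prof (Op s' t') = M" by (intro ext) (simp add: s' t' M12(1))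
  then show ?case by blast
qed

lemma all_cls: "(\<forall>c. P c) \<longleftrightarrow>
    P (False, False) \<and> P (False, True) \<and> P (True, False) \<and> P (True, True)"
  for P :: "cls \<Rightarrow> bool"
  by (metis (full_types) surj_pair)

lemma sum_cls: "sum f UNIV = f (False, False) + f (False, True) + f (True, False) + f (True, True)"
  for f :: "cls \<Rightarrow> nat"
  by (simp add: UNIV_Times_UNIV[symmetric] UNIV_bool sum.cartesian_product[symmetric] del: UNIV_Times_UNIV)

text \<open>A tree that is maximal among those with at most \<open>m c\<close> inner nodes of each class \<open>c\<close> has exactly
that many: otherwise all its leaves lie in saturated classes, and as a tree with an inner node has
two sibling leaves, this contradicts the balance equations.\<close>

theorem realizable:
  assumes bal: "\<And>c. size (M c) + m c = of_bool (c = (False, False)) + m (flipL c) + m (flipR c)"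
    and root: "m (False, False) = 0 \<Longrightarrow> m = (\<lambda>_. 0)"
  shows "\<exists>X. prof X = M"
proof -
  let ?P = "\<lambda>X. \<forall>c. inn X c \<le> m c"
  have P0: "?P (Var 0)" by simp
  have bd: "\<forall>X. ?P X \<longrightarrow> size X < Suc (sum m UNIV)"
    unfolding all_cls size_eq_inn sum_cls by auto
  obtain X where X: "?P X" "\<And>Y. ?P Y \<Longrightarrow> size Y \<le> size X"
    using ex_has_greatest_nat[OF P0 bd] by blast
  \<comment> \<open>A leaf of an unsaturated class could be turned into a product, giving a larger
    tree within the bounds.\<close>
  have stuck: "prof X c = {#}" if c: "inn X c < m c" for c
  proof (rule ccontr)
    assume "prof X c \<noteq> {#}"
    then obtain i p where p: "subt X p = Some (Var i)" "pos_cls p = c"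
      using leaf_at_cls by blast
    let ?Y = "repl X p (Op (Var i) (Var i))"
    have eq: "inn ?Y d = inn X d + of_bool (d = c)" for d
      using inn_repl[OF p(1), of "Op (Var i) (Var i)" d] p(2)
      by (auto simp: cls_add_def prod_eq_iff)
    have "?P ?Y" using X(1) c by (auto simp: eq Suc_le_eq)
    then have "size ?Y \<le> size X" by (rule X(2))
    moreover have "size ?Y = Suc (size X)"
      by (cases c) (auto simp: size_eq_inn eq)
    ultimately show False by simp
  qed
  have "inn X c = m c" for c
  proof (cases "inn X (False, False) = 0")
    case True
    then have 0: "inn X c = 0" for c using inn_root[of X c] by auto
    then have "prof X (False, False) \<noteq> {#}" using inn_balance[of X "(False, False)"] by auto
    then have "m (False, False) = 0" using stuck[of "(False, False)"] 0 by auto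
    with root 0 show ?thesis by simp
  next
    case False
    have le: "inn X c \<le> m c" for c using X(1) by blast
    then have stuck': "inn X c = m c \<or> size (prof X c) = 0" for c
      using stuck[of c] le[of c] by force
    note b = bal inn_balance[of X] le stuck'
    \<comment> \<open>By \<open>cherry\<close> two opposite classes have leaves and are saturated.
      If another class were not, it would have no leaf in \<open>X\<close>, and by the balance
      equations its deficit would be at most the sum of the deficits of those two, which is
      zero.\<close>
    have "\<forall>c. inn X c = m c"
      using cherry[of X] False b[of "(False, False)"] b[of "(False, True)"] b[of "(True, False)"]
        b[of "(True, True)"]
      unfolding all_cls by simp (elim disjE conjE; simp)
    then show ?thesis by blast
  qed
  then have "size (M c) = size (prof X c)" for c
    using bal[of c] inn_balance[of X c] by simp
  then show ?thesis by (rule relabel)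
qed

subsection \<open>Exchanging pairs of opposite leaves\<close>

declare split_paired_All [simp del]

text \<open>These are the classes with coefficient 1 in (1, -1, -1, 1).\<close>

definition diag :: "cls \<Rightarrow> bool" where "diag c \<longleftrightarrow> fst c = snd c"

text \<open>Exchanging \<open>x\<close> and \<open>y\<close> turns one side of M7 into the other;
  \<open>pat2\<close> does the same for M8. Apart from \<open>z\<close> there is one leaf of each
  class.\<close>

definition pat1 :: "nat \<Rightarrow> nat \<Rightarrow> nat \<Rightarrow> gterm" where
  "pat1 x y z = Op (Op (Op (Var x) (Var x)) (Var z)) (Op (Var y) (Var y))"

definition pat2 :: "nat \<Rightarrow> nat \<Rightarrow> nat \<Rightarrow> gterm" where
  "pat2 x y z = Op (Op (Var z) (Op (Var x) (Var x))) (Op (Var y) (Var y))"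

lemma prof_pat1: "prof (pat1 x y z) c =
    (if c = (True, True) then {#z#} else {#}) + (if diag c then {#y#} else {#x#})"
  by (cases c) (auto simp: pat1_def diag_def)

lemma prof_pat2: "prof (pat2 x y z) c =
    (if c = (False, False) then {#z#} else {#}) + (if diag c then {#y#} else {#x#})"
  by (cases c) (auto simp: pat2_def diag_def)

lemma diag_add: "diag (c \<oplus> d) \<longleftrightarrow> diag c = diag d"
  by (auto simp: diag_def cls_add_def)

lemma diag_flip [simp]: "diag (flipL c) = (\<not> diag c)" "diag (flipR c) = (\<not> diag c)"
  by (auto simp: diag_def flip_defs)

lemma diag_pair [simp]: "diag (a, b) = (a = b)"
  by (simp add: diag_def)

definition pat1_inn :: "cls \<Rightarrow> nat" where
  "pat1_inn c = (if c = (False, False) then 2 else if c = (True, True) then 0 else 1)"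

text \<open>The disjuncts say that after cutting out an instance of \<open>pat2\<close> (which has one inner node of
each class) or an instance of \<open>pat1\<close> at a position of class \<open>d\<close>, a realizable profile remains.
The number of leaves of class \<open>c\<close> is \<open>Suc (n c)\<close>, one of them being reserved for the pattern.\<close>

lemma pattern_fits:
  fixes n m :: "cls \<Rightarrow> nat"
  assumes bal: "\<And>c. Suc (n c) + m c = of_bool (c = (False, False)) + m (flipL c) + m (flipR c)"
    and root: "0 < m (False, False)"
  shows "(\<forall>c. 1 \<le> m c) \<and> (m (False, False) = 1 \<longrightarrow> (\<forall>c. m c = 1)) \<or>
    (\<exists>d. 0 < n (flipL (flipR d)) \<and> (\<forall>c. pat1_inn (c \<oplus> d) \<le> m c) \<and>
       (m (False, False) = pat1_inn d \<longrightarrow> (\<forall>c. m c = pat1_inn (c \<oplus> d))))"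
    (is "?A \<or> (\<exists>d. ?B d)")
proof -
  note b = bal[of "(False, False)"] bal[of "(False, True)"] bal[of "(True, False)"]
    bal[of "(True, True)"] root
  note defs = all_cls pat1_inn_def cls_add_def
  \<comment> \<open>An instance of \<open>pat1\<close> at class \<open>d\<close> has no inner node
    of the class opposite to \<open>d\<close>, so \<open>d\<close> is taken opposite to an empty
    class.\<close>
  consider "m (True, True) = 0" | "m (True, False) = 0" | "m (False, True) = 0"
    | "0 < m (True, True)" "0 < m (True, False)" "0 < m (False, True)" by blast
  then show ?thesis
  proof cases
    case 1
    then have "?B (False, False)" using b by (auto simp: defs)
    then show ?thesis by blast
  next
    case 2
    then have "?B (False, True)" using b by (auto simp: defs)
    then show ?thesis by blast
  next
    case 3
    then have "?B (True, False)" using b by (auto simp: defs)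
    then show ?thesis by blast
  next
    case 4
    \<comment> \<open>\<open>pat2\<close> fails only if the root is the sole inner node of its class
      while some other class has more than one; then \<open>pat1\<close> fits below the
      root.\<close>
    then have "?A \<or> ?B (True, True)"
      using b unfolding all_cls by (auto simp: pat1_inn_def cls_add_def)
    then show ?thesis by blast
  qed
qed

text \<open>A leaf inside a copy of \<open>U\<close> put at a leaf of class \<open>d\<close> has
  class \<open>c\<close> iff its class in \<open>U\<close> is \<open>c \<oplus> d\<close>.\<close>

lemma count_prof_subst:
  "count (prof (subst (Var(k := U)) X) c) i = (if i = k then 0 else count (prof X c) i) +
     (\<Sum>d\<in>UNIV. count (prof X d) k * count (prof U (c \<oplus> d)) i)"
proof (induction X arbitrary: c)
  case (Var j)
  show ?case by (cases c) (auto simp: sum_cls)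
next
  case (Op s t)
  have l: "(\<Sum>d\<in>UNIV. f (flipL d)) = sum f UNIV" for f :: "cls \<Rightarrow> nat"
    by (simp add: sum_cls)
  have r: "(\<Sum>d\<in>UNIV. f (flipR d)) = sum f UNIV" for f :: "cls \<Rightarrow> nat"
    by (simp add: sum_cls)
  show ?case
    using l[of "\<lambda>d. count (prof s d) k * count (prof U (flipL c \<oplus> d)) i"]
      r[of "\<lambda>d. count (prof t d) k * count (prof U (flipR c \<oplus> d)) i"]
    by (simp add: Op.IH add_mult_distrib sum.distrib del: fun_upd_apply)
qed

lemma ex_leaf: "\<exists>q z. subt D q = Some (Var z)"
proof (induction D)
  case (Var i)
  have "subt (Var i) [] = Some (Var i)" by simp
  then show ?case by blast
next
  case (Op s t)
  then obtain q z where "subt (Op s t) (False # q) = Some (Var z)" by auto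
  then show ?case by blast
qed

locale sigma_groupoid = class_groupoid +
  assumes M7: "((x \<cdot> x) \<cdot> z) \<cdot> (y \<cdot> y) = ((y \<cdot> y) \<cdot> z) \<cdot> (x \<cdot> x)"
    and M8: "(z \<cdot> (x \<cdot> x)) \<cdot> (y \<cdot> y) = (z \<cdot> (y \<cdot> y)) \<cdot> (x \<cdot> x)"
begin

text \<open>By \<open>ev_cong_prof\<close> the term \<open>S\<close> may be replaced by
  \<open>D\<close> with \<open>U\<close> plugged in at \<open>q\<close>, and there \<open>U\<close>
  by \<open>U'\<close>.\<close>

lemma plug:
  assumes q: "subt D q = Some (Var z)"
    and U: "\<And>v. ev v U = ev v U'"
    and S: "\<And>c. prof S c + prof (Var z) (c \<oplus> pos_cls q) = prof D c + prof U (c \<oplus> pos_cls q)"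
    and S': "\<And>c. M c + prof (Var z) (c \<oplus> pos_cls q) = prof D c + prof U' (c \<oplus> pos_cls q)"
  shows "\<exists>S'. prof S' = M \<and> (\<forall>v. ev v S' = ev v S)"
proof (intro exI conjI allI)
  show "prof (repl D q U') = M"
    using prof_repl[OF q, of U'] S' by (intro ext) (metis add_right_cancel)
  have "prof (repl D q U) = prof S"
    using prof_repl[OF q, of U] S by (intro ext) (metis add_right_cancel)
  then have "ev v (repl D q U) = ev v S" for v by (rule ev_cong_prof)
  moreover have "ev v (repl D q U') = ev v (repl D q U)" for v
    using repl_ctx[OF q, of v] U by metis
  ultimately show "ev v (repl D q U') = ev v S" for v by simp
qed

lemma exchange_pair:
  assumes S: "prof S = (\<lambda>c. K c + (if diag c then {#x#} else {#y#}))"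
  shows "\<exists>S'. prof S' = (\<lambda>c. K c + (if diag c then {#y#} else {#x#})) \<and> (\<forall>v. ev v S' = ev v S)"
proof -
  have bal: "Suc (size (K c)) + inn S c = of_bool (c = (False, False)) + inn S (flipL c) + inn S (flipR c)" for c
    using inn_balance[of S c] by (cases "diag c") (simp_all add: S)
  have "0 < inn S (False, False)"
  proof (rule ccontr)
    assume "\<not> ?thesis"
    then have "inn S c = 0" for c using inn_root[of S c] by auto
    then show False using bal[of "(True, True)"] by simp
  qed
  from pattern_fits[OF bal this] show ?thesis
  proof (elim disjE exE conjE)
    assume m: "\<forall>c. 1 \<le> inn S c" "inn S (False, False) = 1 \<longrightarrow> (\<forall>c. inn S c = 1)"
    have "\<exists>D. prof D = K"
    proof (rule realizable)
      show "size (K c) + (inn S c - 1) =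
          of_bool (c = (False, False)) + (inn S (flipL c) - 1) + (inn S (flipR c) - 1)" for c
        using bal[of c] m(1)[rule_format, of c] m(1)[rule_format, of "flipL c"]
          m(1)[rule_format, of "flipR c"] by linarith
      show "(\<lambda>c. inn S c - 1) = (\<lambda>_. 0)" if "inn S (False, False) - 1 = 0"
      proof -
        have "inn S (False, False) = 1" using that m(1)[rule_format, of "(False, False)"] by linarith
        with m(2) show ?thesis by simp
      qed
    qed
    then obtain D where D: "prof D = K" ..
    obtain q z where q: "subt D q = Some (Var z)" using ex_leaf by blast
    \<comment> \<open>The pattern is shifted by the class of \<open>q\<close>; an off-diagonal shift
      interchanges the roles of \<open>x\<close> and \<open>y\<close>.\<close>
    let ?a = "if diag (pos_cls q) then y else x" and ?b = "if diag (pos_cls q) then x else y"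
    show ?thesis
    proof (rule plug[OF q])
      show "ev v (pat2 ?a ?b z) = ev v (pat2 ?b ?a z)" for v
        by (simp add: pat2_def M8[of "v z"])
    qed (auto simp: S D prof_pat2 diag_add)
  next
    fix d
    assume K: "0 < size (K (flipL (flipR d)))" and m: "\<forall>c. pat1_inn (c \<oplus> d) \<le> inn S c"
      "inn S (False, False) = pat1_inn d \<longrightarrow> (\<forall>c. inn S c = pat1_inn (c \<oplus> d))"
    obtain z where z: "z \<in># K (flipL (flipR d))"
      using K by (auto simp: nonempty_has_size[symmetric])
    \<comment> \<open>In \<open>pat1\<close> the leaf \<open>z\<close> has the class opposite to the
      root. So a \<open>z\<close> is moved from that class to class \<open>d\<close>, where the
      pattern will replace it.\<close>
    define M where "M c = (K c - (if c = flipL (flipR d) then {#z#} else {#})) +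
        (if c = d then {#z#} else {#})" for c
    have MK: "M c + (if c = flipL (flipR d) then {#z#} else {#}) =
        K c + (if c = d then {#z#} else {#})" for c
      using z by (auto simp: M_def)
    have "\<exists>D. prof D = M"
    proof (rule realizable)
      show "size (M c) + (inn S c - pat1_inn (c \<oplus> d)) = of_bool (c = (False, False)) +
          (inn S (flipL c) - pat1_inn (flipL c \<oplus> d)) + (inn S (flipR c) - pat1_inn (flipR c \<oplus> d))" for c
      proof -
        have "size (M c) + of_bool (c = flipL (flipR d)) = size (K c) + of_bool (c = d)"
          using arg_cong[OF MK[of c], of size] by (simp split: if_splits)
        \<comment> \<open>This is the balance equation of \<open>pat1\<close> at
          \<open>c \<oplus> d\<close>, to be subtracted from that of \<open>S\<close>.\<close>
        moreover have "Suc (of_bool (c = flipL (flipR d))) + pat1_inn (c \<oplus> d) =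
            of_bool (c = d) + pat1_inn (flipL c \<oplus> d) + pat1_inn (flipR c \<oplus> d)"
          by (cases c; cases d) (auto simp: pat1_inn_def cls_add_def)
        ultimately show ?thesis
          using bal[of c] m(1)[rule_format, of c] m(1)[rule_format, of "flipL c"]
            m(1)[rule_format, of "flipR c"] by linarith
      qed
      show "(\<lambda>c. inn S c - pat1_inn (c \<oplus> d)) = (\<lambda>_. 0)"
        if "inn S (False, False) - pat1_inn ((False, False) \<oplus> d) = 0"
      proof -
        have "(False, False) \<oplus> d = d" by (simp add: cls_add_def)
        then have "inn S (False, False) = pat1_inn d"
          using that m(1)[rule_format, of "(False, False)"] by simp
        with m(2) show ?thesis by simp
      qed
    qed
    then obtain D where D: "prof D = M" ..
    have "z \<in># prof D d" by (simp add: D M_def)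
    then obtain q where q: "subt D q = Some (Var z)" "pos_cls q = d"
      using leaf_at_cls by blast
    have add_eq: "c \<oplus> d = (True, True) \<longleftrightarrow> c = flipL (flipR d)" "c \<oplus> d = (False, False) \<longleftrightarrow> c = d" for c
      by (auto simp: cls_add_def flip_defs prod_eq_iff)
    let ?a = "if diag d then y else x" and ?b = "if diag d then x else y"
    show ?thesis
    proof (rule plug[OF q(1)])
      show "ev v (pat1 ?a ?b z) = ev v (pat1 ?b ?a z)" for v
        by (simp add: pat1_def M7[of "v x" "v z"])
      show "prof S c + prof (Var z) (c \<oplus> pos_cls q) = prof D c + prof (pat1 ?a ?b z) (c \<oplus> pos_cls q)" for c
        using MK[of c] by (auto simp: S D prof_pat1 diag_add q(2) add_eq)
      show "K c + (if diag c then {#y#} else {#x#}) + prof (Var z) (c \<oplus> pos_cls q) =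
          prof D c + prof (pat1 ?b ?a z) (c \<oplus> pos_cls q)" for c
        using MK[of c] by (auto simp: D prof_pat1 diag_add q(2) add_eq)
    qed
  qed
qed

end

context sigma_groupoid
begin

text \<open>The product of two of the variables is replaced by a fresh variable \<open>k\<close>, whose two occurrences
are then exchanged with those of the third variable.\<close>

lemma exchange_triple:
  assumes S: "prof S = (\<lambda>c. K c + (if diag c then {#x, y, z#} else {#}))"
    and inn: "1 \<le> inn S (True, False)" "1 \<le> inn S (False, True)"
  shows "\<exists>S'. prof S' = (\<lambda>c. K c + (if diag c then {#} else {#x, y, z#})) \<and> (\<forall>v. ev v S' = ev v S)"
proof -
  have "finite ((\<Union>c. set_mset (K c)) \<union> {x, y, z})" by simp
  then obtain k where "k \<notin> (\<Union>c. set_mset (K c)) \<union> {x, y, z}"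
    by (meson infinite_UNIV_nat ex_new_if_finite)
  then have k: "count (K c) k = 0" "x \<noteq> k" "y \<noteq> k" "z \<noteq> k" for c
    unfolding count_eq_zero_iff by blast+
  have off: "\<not> diag c \<Longrightarrow> 1 \<le> inn S c" for c
    using inn by (cases c; cases "fst c"; cases "snd c") auto
  \<comment> \<open>Putting \<open>Op (Var x) (Var y)\<close> for \<open>k\<close> at both
    off-diagonal classes yields \<open>x\<close> and \<open>y\<close> at each diagonal class and one
    inner node at each off-diagonal one, which is why one is subtracted there.\<close>
  have "\<exists>X. prof X = (\<lambda>c. K c + (if diag c then {#z#} else {#k#}))"
  proof (rule realizable)
    show "size (K c + (if diag c then {#z#} else {#k#})) + (inn S c - of_bool (\<not> diag c)) =
        of_bool (c = (False, False)) + (inn S (flipL c) - of_bool (\<not> diag (flipL c)))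
        + (inn S (flipR c) - of_bool (\<not> diag (flipR c)))" for c
      using inn_balance[of S c] off[of c] off[of "flipL c"] off[of "flipR c"]
      by (cases "diag c") (auto simp: S)
    show "(\<lambda>c. inn S c - of_bool (\<not> diag c)) = (\<lambda>_. 0)"
      if "inn S (False, False) - of_bool (\<not> diag (False, False)) = 0"
      using that inn_root[of S "(True, False)"] inn by simp
  qed
  then obtain X where X: "prof X = (\<lambda>c. K c + (if diag c then {#z#} else {#k#}))" ..
  from exchange_pair[OF this] obtain X' where
    X': "prof X' = (\<lambda>c. K c + (if diag c then {#k#} else {#z#}))" and ev: "\<And>v. ev v X' = ev v X"
    by blast
  let ?\<sigma> = "Var(k := Op (Var x) (Var y))"
  have 1: "prof (subst ?\<sigma> X) = prof S"
  proof (intro ext multiset_eqI)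
    show "count (prof (subst ?\<sigma> X) c) i = count (prof S c) i" for c i
      unfolding count_prof_subst S
      by (cases c; cases "fst c"; cases "snd c") (auto simp: X sum_cls k cls_add_def)
  qed
  have 2: "prof (subst ?\<sigma> X') = (\<lambda>c. K c + (if diag c then {#} else {#x, y, z#}))"
  proof (intro ext multiset_eqI)
    show "count (prof (subst ?\<sigma> X') c) i = count (K c + (if diag c then {#} else {#x, y, z#})) i" for c i
      unfolding count_prof_subst
      by (cases c; cases "fst c"; cases "snd c") (auto simp: X' sum_cls k cls_add_def)
  qed
  have "ev v (subst ?\<sigma> X') = ev v S" for v
    using ev_cong_prof[OF 1, of v] by (simp add: evalm_subst ev)
  with 2 show ?thesis by blast
qed

text \<open>Comparing the balance equations of \<open>S\<close> and \<open>T\<close> shows that the size of \<open>A\<close> is divisible by 3.\<close>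

lemma reduce_excess:
  assumes S: "prof S = (\<lambda>c. K c + (if diag c then A else {#}))"
    and T: "prof T = (\<lambda>c. K c + (if diag c then {#} else A))"
    and "A \<noteq> {#}"
  shows "\<exists>K' A' S'. size A' < size A \<and> prof S' = (\<lambda>c. K' c + (if diag c then A' else {#}))
    \<and> prof T = (\<lambda>c. K' c + (if diag c then {#} else A')) \<and> (\<forall>v. ev v S' = ev v S)"
proof -
  have bS: "size (K c) + (if diag c then size A else 0) + inn S c =
      of_bool (c = (False, False)) + inn S (flipL c) + inn S (flipR c)" for c
    using inn_balance[of S c] by (simp add: S if_distrib[of size] cong: if_cong)
  have bT: "size (K c) + (if diag c then 0 else size A) + inn T c =
      of_bool (c = (False, False)) + inn T (flipL c) + inn T (flipR c)" for c
    using inn_balance[of T c] by (simp add: T if_distrib[of size] cong: if_cong)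
  note b = bS[of "(False, False)"] bS[of "(True, False)"] bS[of "(False, True)"] bS[of "(True, True)"]
    bT[of "(False, False)"] bT[of "(True, False)"] bT[of "(False, True)"] bT[of "(True, True)"]
  \<comment> \<open>The difference of the inner node counts is some a on and b off the diagonal,
    with \<open>size A\<close> + a = 2b and b - \<open>size A\<close> = 2a, so \<open>size A\<close>
    = 3b.\<close>
  have "3 * inn S (True, False) = 3 * inn T (True, False) + size A"
    using b by simp
  moreover have "3 * inn S (False, True) = 3 * inn T (False, True) + size A"
    using b by simp
  moreover have "0 < size A" using \<open>A \<noteq> {#}\<close> by (simp add: nonempty_has_size)
  ultimately have inn: "1 \<le> inn S (True, False)" "1 \<le> inn S (False, True)" and "3 \<le> size A"
    by presburger+
  then obtain B A' where AB: "A = A' + B" "size B = 3"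
    using split_multiset[of A "size A - 3" 3] by auto
  obtain xs where "B = mset xs" by (metis ex_mset)
  with \<open>size B = 3\<close> obtain x y z where B: "B = {#x, y, z#}"
    by (auto simp: numeral_3_eq_3 length_Suc_conv)
  \<comment> \<open>After the exchange \<open>B\<close> sits off the diagonal in both terms and
    joins the common part.\<close>
  let ?K = "\<lambda>c. K c + (if diag c then {#} else B)"
  have "prof S = (\<lambda>c. (K c + (if diag c then A' else {#})) + (if diag c then {#x, y, z#} else {#}))"
    by (auto simp: S AB B)
  from exchange_triple[OF this inn] obtain S' where
    S': "prof S' = (\<lambda>c. (K c + (if diag c then A' else {#})) + (if diag c then {#} else {#x, y, z#}))"
    and ev: "\<forall>v. ev v S' = ev v S" by blast
  have "prof S' = (\<lambda>c. ?K c + (if diag c then A' else {#}))"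
    unfolding S' by (auto simp: B)
  moreover have "prof T = (\<lambda>c. ?K c + (if diag c then {#} else A'))"
    unfolding T by (auto simp: AB)
  moreover have "size A' < size A" using AB by simp
  ultimately show ?thesis
    using ev by (intro exI[of _ ?K] exI[of _ A'] exI[of _ S'] conjI)
qed

text \<open>Induction on the excess: \<open>exchange_pair\<close> cancels one variable of
  \<open>A\<close> against one of \<open>B\<close>, and \<open>reduce_excess\<close> shrinks a
  one-sided excess, with \<open>S\<close> and \<open>T\<close> interchanged if only \<open>B\<close>
  is left.\<close>

theorem ev_cong_excess:
  assumes "prof S = (\<lambda>c. K c + (if diag c then A else B))"
    and "prof T = (\<lambda>c. K c + (if diag c then B else A))"
  shows "ev v S = ev v T"
  using assms
proof (induction "size A + size B" arbitrary: K A B S T rule: less_induct)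
  case less
  consider "A = {#}" "B = {#}" | "A = {#}" "B \<noteq> {#}" | "A \<noteq> {#}" "B = {#}" | "A \<noteq> {#}" "B \<noteq> {#}"
    by blast
  then show ?case
  proof cases
    case 1
    then show ?thesis by (intro ev_cong_prof ext) (simp add: less.prems)
  next
    case 2
    obtain K' B' T' where "size B' < size B" "prof T' = (\<lambda>c. K' c + (if diag c then B' else {#}))"
      "prof S = (\<lambda>c. K' c + (if diag c then {#} else B'))" "\<forall>v. ev v T' = ev v T"
      using reduce_excess[of T K B S] less.prems 2 by auto
    with less.hyps[of B' "{#}" T' K' S] show ?thesis by simp
  next
    case 3
    obtain K' A' S' where "size A' < size A" "prof S' = (\<lambda>c. K' c + (if diag c then A' else {#}))"
      "prof T = (\<lambda>c. K' c + (if diag c then {#} else A'))" "\<forall>v. ev v S' = ev v S"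
      using reduce_excess[of S K A T] less.prems 3 by auto
    with less.hyps[of A' "{#}" S' K' T] 3 show ?thesis by simp
  next
    case 4
    then obtain x A' y B' where AB: "A = add_mset x A'" "B = add_mset y B'"
      by (meson multiset_cases)
    have "prof S = (\<lambda>c. (K c + (if diag c then A' else B')) + (if diag c then {#x#} else {#y#}))"
      by (auto simp: less.prems AB)
    from exchange_pair[OF this] obtain S' where
      S': "prof S' = (\<lambda>c. (K c + (if diag c then A' else B')) + (if diag c then {#y#} else {#x#}))"
      and ev: "\<forall>v. ev v S' = ev v S" by blast
    let ?K = "\<lambda>c. K c + (if diag c then {#y#} else {#x#})"
    have "ev v S' = ev v T"
    proof (rule less.hyps[of A' B' S' ?K])
      show "size A' + size B' < size A + size B" by (simp add: AB)
      show "prof S' = (\<lambda>c. ?K c + (if diag c then A' else B'))" by (auto simp: S')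
      show "prof T = (\<lambda>c. ?K c + (if diag c then B' else A'))" by (auto simp: less.prems AB)
    qed
    with ev show ?thesis by simp
  qed
qed

end

subsection \<open>Completeness\<close>

lemma eval_profile:
  fixes i :: nat
  defines "v \<equiv> \<lambda>j. of_bool (j = i)"
  defines "n \<equiv> \<lambda>t a b. int (count (prof t (a, b)) i)"
  shows "eval (\<lambda>x y. x + y) v t = n t False False + n t True False + n t False True + n t True True"
    and "eval (\<lambda>x y. x - y) v t = n t False False + n t True False - n t False True - n t True True"
    and "eval (\<lambda>x y. - x + y) v t = n t False False - n t True False + n t False True - n t True True"
  by (induction t) (auto simp: v_def n_def)

text \<open>For each variable the three operations give three linear equations in the four
  occurrence differences, with solution line spanned by (1, -1, -1, 1).\<close>

lemma Sigma123_excess: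
  assumes "(S, T) \<in> Sigma123"
  obtains K A B where "prof S = (\<lambda>c. K c + (if diag c then A else B))"
    "prof T = (\<lambda>c. K c + (if diag c then B else A))"
proof
  let ?A = "prof S (False, False) - prof T (False, False)"
  let ?B = "prof T (False, False) - prof S (False, False)"
  let ?K = "\<lambda>c. prof S c \<inter># prof T c"
  have cnt: "int (count (prof S c) i) - int (count (prof T c) i) =
      (if diag c then 1 else - 1) *
      (int (count (prof S (False, False)) i) - int (count (prof T (False, False)) i))" for c i
  proof -
    let ?v = "\<lambda>j. of_bool (j = i)"
    have "eval (\<lambda>x y. x + y) ?v S = eval (\<lambda>x y. x + y) ?v T"
      and "eval (\<lambda>x y. x - y) ?v S = eval (\<lambda>x y. x - y) ?v T"
      and "eval (\<lambda>x y. - x + y) ?v S = eval (\<lambda>x y. - x + y) ?v T"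
      using assms unfolding Sigma123_def holds_in_def mem_Collect_eq fst_conv snd_conv by blast+
    then show ?thesis
      unfolding eval_profile by (cases c; cases "fst c"; cases "snd c") auto
  qed
  show "prof S = (\<lambda>c. ?K c + (if diag c then ?A else ?B))"
  proof (intro ext multiset_eqI)
    show "count (prof S c) i = count (?K c + (if diag c then ?A else ?B)) i" for c i
      using cnt[of c i] by (cases "diag c") auto
  qed
  show "prof T = (\<lambda>c. ?K c + (if diag c then ?B else ?A))"
  proof (intro ext multiset_eqI)
    show "count (prof T c) i = count (?K c + (if diag c then ?B else ?A)) i" for c i
      using cnt[of c i] by (cases "diag c") auto
  qed
qed

\<comment> \<open>The free groupoid on countably many generators in the variety defined by
  \<open>B123\<close>: two terms have equal values there iff their identity is a
  consequence.\<close>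
quotient_type free_groupoid = gterm / "\<lambda>s t. (s, t) \<in> consequences B123"
proof (rule equivpI)
  show "reflp (\<lambda>s t. (s, t) \<in> consequences B123)"
    by (rule reflpI) (rule consequences.refl)
  show "symp (\<lambda>s t. (s, t) \<in> consequences B123)"
    by (rule sympI) (rule consequences.sym)
  show "transp (\<lambda>s t. (s, t) \<in> consequences B123)"
    by (rule transpI) (rule consequences.trans)
qed

lift_definition free_mul :: "free_groupoid \<Rightarrow> free_groupoid \<Rightarrow> free_groupoid" is Op
  by (rule consequences.cong)

lift_definition free_var :: "nat \<Rightarrow> free_groupoid" is Var .

lemma evalm_free: "evalm free_mul free_var t = abs_free_groupoid t"
  by (induction t) (simp_all add: free_var.abs_eq free_mul.abs_eq)

text \<open>The variable \<open>E\<close> keeps the set inside \<open>consequences\<close> folded when \<open>B123_def\<close> is unfolded.\<close>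

lemma consequences_instances:
  assumes E: "E = B123"
  shows "(Op (Op x y) (Op z t), Op (Op x z) (Op y t)) \<in> consequences E"
    and "(Op (Op x y) (Op z t), Op (Op t y) (Op z x)) \<in> consequences E"
    and "(Op (Op (Op x y) z) t, Op (Op (Op x t) z) y) \<in> consequences E"
    and "(Op (Op x (Op y z)) t, Op (Op x (Op t z)) y) \<in> consequences E"
    and "(Op x (Op (Op y z) t), Op z (Op (Op y x) t)) \<in> consequences E"
    and "(Op x (Op y (Op z t)), Op z (Op y (Op x t))) \<in> consequences E"
    and "(Op (Op (Op x x) z) (Op y y), Op (Op (Op y y) z) (Op x x)) \<in> consequences E"
    and "(Op (Op z (Op x x)) (Op y y), Op (Op z (Op y y)) (Op x x)) \<in> consequences E"
proof -
  have "(subst ((!) [x, y, z, t]) (fst e), subst ((!) [x, y, z, t]) (snd e)) \<in> consequences E"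
    if "e \<in> B123" for e
    by (rule consequences.subst, rule consequences.ax) (simp add: that E)
  then have "\<forall>e\<in>B123. (subst ((!) [x, y, z, t]) (fst e), subst ((!) [x, y, z, t]) (snd e)) \<in> consequences E"
    by blast
  then show "(Op (Op x y) (Op z t), Op (Op x z) (Op y t)) \<in> consequences E"
    and "(Op (Op x y) (Op z t), Op (Op t y) (Op z x)) \<in> consequences E"
    and "(Op (Op (Op x y) z) t, Op (Op (Op x t) z) y) \<in> consequences E"
    and "(Op (Op x (Op y z)) t, Op (Op x (Op t z)) y) \<in> consequences E"
    and "(Op x (Op (Op y z) t), Op z (Op (Op y x) t)) \<in> consequences E"
    and "(Op x (Op y (Op z t)), Op z (Op y (Op x t))) \<in> consequences E"
    and "(Op (Op (Op x x) z) (Op y y), Op (Op (Op y y) z) (Op x x)) \<in> consequences E"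
    and "(Op (Op z (Op x x)) (Op y y), Op (Op z (Op y y)) (Op x x)) \<in> consequences E"
    unfolding B123_def by simp_all
qed

interpretation free: sigma_groupoid free_mul
  by unfold_locales (transfer, rule consequences_instances, rule HOL.refl)+

lemma Sigma123_subset: "Sigma123 \<subseteq> consequences B123"
proof
  fix e assume e: "e \<in> Sigma123"
  obtain S T where ST: "e = (S, T)" by (cases e)
  with e obtain K A B where "prof S = (\<lambda>c. K c + (if diag c then A else B))"
    "prof T = (\<lambda>c. K c + (if diag c then B else A))"
    using Sigma123_excess by blast
  then have "evalm free_mul free_var S = evalm free_mul free_var T"
    by (rule free.ev_cong_excess)
  then show "e \<in> consequences B123"
    by (simp add: evalm_free free_groupoid.abs_eq_iff ST)
qed

lemma B123_subset: "consequences B123 \<subseteq> Sigma123"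
proof
  fix e assume e: "e \<in> consequences B123"
  have "holds_in f e" if "f \<in> {\<lambda>x y. x + y, \<lambda>x y. x - y, \<lambda>x y. - x + y}" for f
    unfolding holds_in_def eval_eq_evalm
    using that by (intro allI consequences_sound[OF e]) (auto simp: B123_def)
  then show "e \<in> Sigma123" by (simp add: Sigma123_def)
qed

subsection \<open>Independence\<close>

text \<open>In the tables below no argument is 0, so the default value 0 is an absorbing
  element.\<close>

definition table :: "((nat \<times> nat) \<times> nat) list \<Rightarrow> nat \<Rightarrow> nat \<Rightarrow> nat" where
  "table T x y = (case map_of T (x, y) of None \<Rightarrow> 0 | Some z \<Rightarrow> z)"

lemma table_eq_iff:
  "distinct (map fst T) \<Longrightarrow> w \<noteq> 0 \<Longrightarrow> table T x y = w \<longleftrightarrow> ((x, y), w) \<in> set T"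
  by (auto simp: table_def split: option.split dest: map_of_SomeD
      intro: eq_key_imp_eq_value weak_map_of_SomeI)

definition separates :: "((nat \<times> nat) \<times> nat) list \<Rightarrow> identity \<Rightarrow> bool" where
  "separates T e \<longleftrightarrow>
     (\<forall>e'\<in>B123 - {e}. \<forall>v. evalm (table T) v (fst e') = evalm (table T) v (snd e')) \<and>
     (\<exists>v. evalm (table T) v (fst e) \<noteq> evalm (table T) v (snd e))"

text \<open>Two numbers are equal once they equal the same nonzero \<open>w\<close>, the form to
  which \<open>table_eq_iff\<close> applies.\<close>

lemma separatesI:
  assumes "\<forall>e'\<in>B123 - {e}. \<forall>v w. w \<noteq> 0 \<longrightarrow>
      (evalm (table T) v (fst e') = w \<longleftrightarrow> evalm (table T) v (snd e') = w)"
    and "evalm (table T) v (fst e) \<noteq> evalm (table T) v (snd e)"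
  shows "separates T e"
  unfolding separates_def
proof (rule conjI)
  show "\<forall>e'\<in>B123 - {e}. \<forall>v. evalm (table T) v (fst e') = evalm (table T) v (snd e')"
  proof (rule ballI, rule allI)
    fix e' v assume "e' \<in> B123 - {e}"
    from bspec[OF assms(1) this] show "evalm (table T) v (fst e') = evalm (table T) v (snd e')"
      by (metis (full_types))
  qed
qed (rule exI, rule assms(2))

lemma separates_independent: "separates T e \<Longrightarrow> e \<notin> consequences (B123 - {e})"
  unfolding separates_def using consequences_sound by blast

text \<open>The tables come from a finite model search. They are mostly zero, so that by \<open>table_eq_iff\<close> the
condition for a nonzero value of a term expands to a short disjunction.\<close>

lemma separates_M1: "separates [((1,1),3), ((2,1),4), ((3,4),5)]
    (Op (Op vx vy) (Op vz vt), Op (Op vx vz) (Op vy vt))"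
  \<comment> \<open>Here (11)(21) = 34 = 5, whereas (12)(11) = 03 = 0.\<close>
  by (rule separatesI[where v = "(!) [1,1,2,1]", rotated], simp add: table_def,
    (simp add: B123_def insert_Diff_if table_eq_iff; auto))

lemma separates_M2: "separates [((2,3),1), ((4,1),3), ((4,4),2)]
    (Op (Op vx vy) (Op vz vt), Op (Op vt vy) (Op vz vx))"
  by (rule separatesI[where v = "(!) [1,4,4,4]", rotated], simp add: table_def,
    (simp add: B123_def insert_Diff_if table_eq_iff; auto))

lemma separates_M3: "separates [((1,3),2), ((2,1),2)]
    (Op (Op (Op vx vy) vz) vt, Op (Op (Op vx vt) vz) vy)"
  by (rule separatesI[where v = "(!) [1,1,1,3]", rotated], simp add: table_def,
    (simp add: B123_def insert_Diff_if table_eq_iff; auto))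

lemma separates_M4: "separates [((3,2),1), ((4,3),3)]
    (Op (Op vx (Op vy vz)) vt, Op (Op vx (Op vt vz)) vy)"
  by (rule separatesI[where v = "(!) [4,2,3,4]", rotated], simp add: table_def,
    (simp add: B123_def insert_Diff_if table_eq_iff; auto))

lemma separates_M5: "separates [((3,2),1), ((3,4),4), ((4,3),2)]
    (Op vx (Op (Op vy vz) vt), Op vz (Op (Op vy vx) vt))"
  by (rule separatesI[where v = "(!) [3,3,4,3]", rotated], simp add: table_def,
    (simp add: B123_def insert_Diff_if table_eq_iff; auto))

lemma separates_M6: "separates [((1,1),2), ((3,2),2)]
    (Op vx (Op vy (Op vz vt)), Op vz (Op vy (Op vx vt)))"
  by (rule separatesI[where v = "(!) [1,3,3,1]", rotated], simp add: table_def,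
    (simp add: B123_def insert_Diff_if table_eq_iff; auto))

lemma separates_M7: "separates
    [((1,4),5), ((2,2),1), ((2,3),1), ((4,1),3), ((4,4),2), ((5,2),1), ((5,3),1)]
    (Op (Op (Op vx vx) vz) (Op vy vy), Op (Op (Op vy vy) vz) (Op vx vx))"
  by (rule separatesI[where v = "(!) [2,4,4]", rotated], simp add: table_def,
    (simp add: B123_def insert_Diff_if table_eq_iff; auto))

lemma separates_M8: "separates
    [((1,1),2), ((1,3),5), ((2,2),3), ((2,4),6), ((3,1),4), ((5,2),6)]
    (Op (Op vz (Op vx vx)) (Op vy vy), Op (Op vz (Op vy vy)) (Op vx vx))"
  by (rule separatesI[where v = "(!) [1,2,1]", rotated], simp add: table_def,
    (simp add: B123_def insert_Diff_if table_eq_iff; auto))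

theorem theorem5p1:
  shows "is_basis B123 Sigma123 \<and> independent B123"
proof
  show "is_basis B123 Sigma123"
    unfolding is_basis_def using B123_subset Sigma123_subset by blast
  have "\<exists>T. separates T e" if "e \<in> B123" for e
    using that separates_M1 separates_M2 separates_M3 separates_M4
      separates_M5 separates_M6 separates_M7 separates_M8
    unfolding B123_def by blast
  then show "independent B123"
    unfolding independent_def using separates_independent by blast
qed

end
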